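(* A tree $T$ rooted at infinity admits a doubling flow measure if and only if it has uniformly bounded degree and $$\sup_{\gamma\in\Gamma}n(\gamma)=M<\infty,$$ where $\Gamma$ is the family of geodesics of $T$ and $n(\gamma)=|\{y\in\gamma:\ q(y)\ge2\}|$ counts the vertices of $\gamma$ having at least two sons.
   Context: Tree rooted at infinity: $T=(V,E)$ is an (undirected) tree with vertex set $V$ and geodesic distance $d$, $o\in V$ is a fixed origin, and a half-infinite geodesic starting at $o$ is fixed; the boundary point it identifies is the root. For $x\in V$ let $\Pi(x)$ be the vertex of this geodesic closest to $x$; the level of $x$ is $\ell(x)=d(o,\Pi(x))-d(\Pi(x),x)$. The set of sons of $x$ is $s(x)=\{y\sim x:\ \ell(y)=\ell(x)-1\}$, and $q(x)=|s(x)|$, i.e. the number of neighbours of $x$ minus 1. Uniformly bounded degree means that there is a constant $q$ with $q(x)\le q$ for all $x\in V$. A geodesic is a (finite or infinite) path realizing the distance $d$ between any two of its vertices. Flow measure: a strictly positive function $m:V\to(0,\infty)$ with $m(x)=\sum_{y\in s(x)}m(y)$ for all $x\in V$; it is also regarded as the measure $m(A)=\sum_{x\in A}m(x)$, $A\subseteq V$. It is doubling if there is a constant $C>1$ with $m(B_{2r}(x))\le C\,m(B_r(x))$ for all $x\in V$ and all radii $r>0$, where $B_r(x)=\{y\in V:d(x,y)\le r\}$, $r\in\mathbb N$.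
   Formalization: Every vertex is assumed to have at least one son (q(x) ≥ 1); without this the claim fails for the half-line rooted at its end, where the leaf would need m = 0. A tree with a vertex without sons admits no flow measure at all. *)

theory Defs
  imports "HOL-Analysis.Infinite_Sum"
begin

section \<open>Trees\<close>

text \<open>
  A simple undirected graph is a vertex set \<open>V\<close> with a symmetric, irreflexive adjacency
  relation \<open>E\<close>.  Neither finiteness nor local finiteness is assumed.
\<close>

definition walk_between :: "('a \<Rightarrow> 'a \<Rightarrow> bool) \<Rightarrow> 'a \<Rightarrow> 'a list \<Rightarrow> 'a \<Rightarrow> bool" where
  "walk_between E x xs y \<longleftrightarrow> xs \<noteq> [] \<and> hd xs = x \<and> last xs = y \<and> successively E xs"

definition graph_cycle :: "('a \<Rightarrow> 'a \<Rightarrow> bool) \<Rightarrow> 'a list \<Rightarrow> bool" where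
  "graph_cycle E xs \<longleftrightarrow>
     length xs \<ge> 3 \<and> distinct xs \<and> successively E xs \<and> E (last xs) (hd xs)"

locale undirected_tree =
  fixes V :: "'a set" and E :: "'a \<Rightarrow> 'a \<Rightarrow> bool"
  assumes edge_in_V: "E x y \<Longrightarrow> x \<in> V \<and> y \<in> V"
    and edge_sym: "E x y \<Longrightarrow> E y x"
    and edge_irrefl: "\<not> E x x"
    and connected: "x \<in> V \<Longrightarrow> y \<in> V \<Longrightarrow> \<exists>xs. walk_between E x xs y"
    and acyclic: "\<not> graph_cycle E xs"

text \<open>
  Minimal number of edges of a walk; only meaningful for vertices joined by some walk.
\<close>

definition gdist :: "('a \<Rightarrow> 'a \<Rightarrow> bool) \<Rightarrow> 'a \<Rightarrow> 'a \<Rightarrow> nat" where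
  "gdist E x y = (LEAST n. \<exists>xs. walk_between E x xs y \<and> length xs = Suc n)"

definition gball :: "'a set \<Rightarrow> ('a \<Rightarrow> 'a \<Rightarrow> bool) \<Rightarrow> 'a \<Rightarrow> nat \<Rightarrow> 'a set" where
  "gball V E x r = {y \<in> V. gdist E x y \<le> r}"

text \<open>
  Geodesics, as sets of vertices.  The parameter set \<open>I\<close> is a nonempty interval of integers,
  so that finite, half-infinite and bi-infinite geodesics are all included; parameters
  \<open>i\<close> and \<open>i + 1\<close> are mapped to vertices at distance 1, i.e. to neighbours.
\<close>

definition geodesics :: "'a set \<Rightarrow> ('a \<Rightarrow> 'a \<Rightarrow> bool) \<Rightarrow> 'a set set" where
  "geodesics V E = {\<gamma> ` I | (\<gamma> :: int \<Rightarrow> 'a) (I :: int set).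
     I \<noteq> {} \<and> (\<forall>i\<in>I. \<forall>j\<in>I. {i..j} \<subseteq> I) \<and>
     \<gamma> ` I \<subseteq> V \<and> (\<forall>i\<in>I. \<forall>j\<in>I. int (gdist E (\<gamma> i) (\<gamma> j)) = \<bar>i - j\<bar>)}"


section \<open>Trees rooted at infinity\<close>

text \<open>
  \<open>\<omega>\<close> is the fixed half-infinite geodesic; its starting point \<open>\<omega> 0\<close> is the origin.
\<close>

locale tree_rooted_at_infinity = undirected_tree V E
  for V :: "'a set" and E :: "'a \<Rightarrow> 'a \<Rightarrow> bool" +
  fixes \<omega> :: "nat \<Rightarrow> 'a"
  assumes ray_in_V: "\<omega> i \<in> V"
    and ray_geodesic: "i \<le> j \<Longrightarrow> gdist E (\<omega> i) (\<omega> j) = j - i"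

definition ray_proj :: "('a \<Rightarrow> 'a \<Rightarrow> bool) \<Rightarrow> (nat \<Rightarrow> 'a) \<Rightarrow> 'a \<Rightarrow> 'a" where
  "ray_proj E \<omega> x = arg_min_on (gdist E x) (range \<omega>)"

definition level :: "('a \<Rightarrow> 'a \<Rightarrow> bool) \<Rightarrow> (nat \<Rightarrow> 'a) \<Rightarrow> 'a \<Rightarrow> int" where
  "level E \<omega> x = int (gdist E (\<omega> 0) (ray_proj E \<omega> x)) - int (gdist E (ray_proj E \<omega> x) x)"

definition sons :: "('a \<Rightarrow> 'a \<Rightarrow> bool) \<Rightarrow> (nat \<Rightarrow> 'a) \<Rightarrow> 'a \<Rightarrow> 'a set" where
  "sons E \<omega> x = {y. E x y \<and> level E \<omega> y = level E \<omega> x - 1}"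

text \<open>
  Cardinality with value \<open>\<infinity>\<close> on infinite sets (\<^const>\<open>card\<close> is 0 there).
\<close>

definition ecard :: "'b set \<Rightarrow> enat" where
  "ecard A = (if finite A then enat (card A) else \<infinity>)"

definition num_sons :: "('a \<Rightarrow> 'a \<Rightarrow> bool) \<Rightarrow> (nat \<Rightarrow> 'a) \<Rightarrow> 'a \<Rightarrow> enat" where
  "num_sons E \<omega> x = ecard (sons E \<omega> x)"

definition uniformly_bounded_degree ::
    "'a set \<Rightarrow> ('a \<Rightarrow> 'a \<Rightarrow> bool) \<Rightarrow> (nat \<Rightarrow> 'a) \<Rightarrow> bool" where
  "uniformly_bounded_degree V E \<omega> \<longleftrightarrow> (\<exists>q::nat. \<forall>x\<in>V. num_sons E \<omega> x \<le> enat q)"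

definition num_branching ::
    "('a \<Rightarrow> 'a \<Rightarrow> bool) \<Rightarrow> (nat \<Rightarrow> 'a) \<Rightarrow> 'a set \<Rightarrow> enat" where
  "num_branching E \<omega> \<gamma> = ecard {y \<in> \<gamma>. num_sons E \<omega> y \<ge> 2}"


section \<open>Flow measures\<close>

definition flow_measure ::
    "'a set \<Rightarrow> ('a \<Rightarrow> 'a \<Rightarrow> bool) \<Rightarrow> (nat \<Rightarrow> 'a) \<Rightarrow> ('a \<Rightarrow> real) \<Rightarrow> bool" where
  "flow_measure V E \<omega> m \<longleftrightarrow>
     (\<forall>x\<in>V. m x > 0) \<and> (\<forall>x\<in>V. (m has_sum m x) (sons E \<omega> x))"

text \<open>
  The measure with density \<open>m\<close>, with values in \<open>[0, \<infinity>]\<close>, where every sum exists.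
\<close>

definition mass :: "('a \<Rightarrow> real) \<Rightarrow> 'a set \<Rightarrow> ennreal" where
  "mass m A = (\<Sum>\<^sub>\<infinity>x\<in>A. ennreal (m x))"

definition doubling :: "'a set \<Rightarrow> ('a \<Rightarrow> 'a \<Rightarrow> bool) \<Rightarrow> ('a \<Rightarrow> real) \<Rightarrow> bool" where
  "doubling V E m \<longleftrightarrow> (\<exists>C::real. C > 1 \<and>
     (\<forall>x\<in>V. \<forall>r::nat. r > 0 \<longrightarrow>
        mass m (gball V E x (2 * r)) \<le> ennreal C * mass m (gball V E x r)))"

end

theory Submission
  imports Defs
begin

text \<open>
  At each level, the vertices of \<open>B\<^sub>r(x)\<close> descend from the ancestor \<open>p\<^sup>r(x)\<close>, so a flow
  measure gives the ball mass at most \<open>(2r + 1) m(p\<^sup>r(x))\<close>; the ancestors of \<open>x\<close> alone give at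
  least \<open>(r + 1) m(x)\<close>.  If \<open>m\<close> is doubling with constant \<open>C\<close>, comparing balls around deep
  descendants of \<open>x\<close> yields \<open>m(p\<^sup>n(x)) \<le> 4 C m(x)\<close> for all \<open>n\<close>.  This bounds the degree, and
  since each branching ancestor of \<open>x\<close> adds at least \<open>m(x) / 4 C\<close> to the flow it bounds their
  number; every vertex of a geodesic segment is an ancestor of one of its ends.  Conversely,
  dividing the flow equally among the sons gives a measure bounded above and away from 0,
  because the ancestors of a vertex form a geodesic.
\<close>

section \<open>Distance and level\<close>

text \<open>Relation powers replace vertex lists, so that facts about distances can be proved by
  induction on the number of steps.\<close>

lemma walk_iff_relpowp:
  "(\<exists>xs. walk_between E x xs y \<and> length xs = Suc n) \<longleftrightarrow> (E ^^ n) x y"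
proof (induction n arbitrary: y)
  case 0
  have "walk_between E x [x] x" by (simp add: walk_between_def)
  then show ?case by (auto simp: walk_between_def length_Suc_conv intro!: exI[of _ "[x]"])
next
  case (Suc n)
  show ?case
  proof
    assume "\<exists>xs. walk_between E x xs y \<and> length xs = Suc (Suc n)"
    then obtain xs where xs: "walk_between E x xs y" "length xs = Suc (Suc n)" by blast
    then obtain ys where ys: "xs = ys @ [y]"
      by (cases xs rule: rev_cases) (auto simp: walk_between_def)
    with xs(2) have "ys \<noteq> []" by auto
    with xs ys have "walk_between E x ys (last ys)" "length ys = Suc n" "E (last ys) y"
      by (auto simp: walk_between_def successively_append_iff)
    with Suc.IH show "(E ^^ Suc n) x y" by auto
  next
    assume "(E ^^ Suc n) x y"
    then obtain z where "(E ^^ n) x z" "E z y" by auto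
    with Suc.IH obtain xs where "walk_between E x xs z" "length xs = Suc n" by blast
    with \<open>E z y\<close> have "walk_between E x (xs @ [y]) y" "length (xs @ [y]) = Suc (Suc n)"
      by (auto simp: walk_between_def successively_append_iff)
    then show "\<exists>xs. walk_between E x xs y \<and> length xs = Suc (Suc n)" by blast
  qed
qed

lemma gdist_eq_Least: "gdist E x y = (LEAST n. (E ^^ n) x y)"
  by (simp add: gdist_def walk_iff_relpowp)

lemma gdist_le: "(E ^^ n) x y \<Longrightarrow> gdist E x y \<le> n"
  by (simp add: gdist_eq_Least Least_le)

lemma gdist_refl [simp]: "gdist E x x = 0"
  using gdist_le[of 0 E x x] by simp

section \<open>Separation by a vertex and uniqueness of the closer neighbour\<close>

context undirected_tree
begin

lemma gdist_walk:
  assumes "x \<in> V" "y \<in> V"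
  shows "(E ^^ gdist E x y) x y"
proof -
  obtain xs where xs: "walk_between E x xs y" using connected assms by blast
  then obtain n where "length xs = Suc n" by (cases xs) (auto simp: walk_between_def)
  with xs have "(E ^^ n) x y" using walk_iff_relpowp by metis
  then show ?thesis unfolding gdist_eq_Least by (rule LeastI)
qed

lemma relpowp_sym: "(E ^^ n) x y \<Longrightarrow> (E ^^ n) y x"
proof (induction n arbitrary: y)
  case (Suc n)
  then obtain z where "(E ^^ n) x z" "E z y" by auto
  with Suc.IH show ?case by (metis edge_sym relpowp_Suc_I2)
qed simp

lemma gdist_sym: "gdist E x y = gdist E y x"
  unfolding gdist_eq_Least by (metis relpowp_sym)

lemma gdist_eq_0_iff: "x \<in> V \<Longrightarrow> y \<in> V \<Longrightarrow> gdist E x y = 0 \<longleftrightarrow> x = y"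
  using gdist_walk[of x y] by auto

lemma gdist_edge_le: "r \<in> V \<Longrightarrow> E y z \<Longrightarrow> gdist E r z \<le> Suc (gdist E r y)"
  using gdist_walk[of r y] edge_in_V by (intro gdist_le) auto

lemma gdist_pred:
  assumes "r \<in> V" "y \<in> V" "gdist E r y = Suc n"
  obtains y' where "E y y'" "gdist E r y' = n"
proof -
  obtain z where z: "(E ^^ n) r z" "E z y" using gdist_walk[OF assms(1,2)] assms(3) by auto
  then have "gdist E r z \<le> n" "Suc n \<le> Suc (gdist E r z)"
    using gdist_le[OF z(1)] gdist_edge_le[OF assms(1) z(2)] assms(3) by auto
  with z show thesis using that edge_sym by force
qed

text \<open>The edges of the tree with \<open>x\<close> deleted; connectivity in this graph is the
  form in which acyclicity is used.\<close>

definition avoiding :: "'a \<Rightarrow> ('a \<times> 'a) set" where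
  "avoiding x = {(u, v). E u v \<and> u \<noteq> x \<and> v \<noteq> x}"

lemma avoiding_rtrancl_sym: "(u, v) \<in> (avoiding x)\<^sup>* \<Longrightarrow> (v, u) \<in> (avoiding x)\<^sup>*"
proof -
  have "sym (avoiding x)" by (auto simp: avoiding_def intro!: symI edge_sym)
  then show "(u, v) \<in> (avoiding x)\<^sup>* \<Longrightarrow> (v, u) \<in> (avoiding x)\<^sup>*"
    using sym_rtrancl by (metis symD)
qed

text \<open>Induction along the walk: a vertex new to the path is appended, a vertex already met
  truncates the path there.\<close>

lemma avoiding_path:
  assumes "(y, z) \<in> (avoiding x)\<^sup>*" "y \<noteq> x"
  shows "\<exists>xs. xs \<noteq> [] \<and> hd xs = y \<and> last xs = z \<and> successively E xs \<and> distinct xs \<and> x \<notin> set xs"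
  using assms(1)
proof (induction rule: rtrancl_induct)
  case base
  then show ?case using assms(2) by (intro exI[of _ "[y]"]) auto
next
  case (step z w)
  then obtain xs where xs: "xs \<noteq> []" "hd xs = y" "last xs = z" "successively E xs" "distinct xs"
    "x \<notin> set xs" by blast
  show ?case
  proof (cases "w \<in> set xs")
    case True
    then obtain us vs where "xs = (us @ [w]) @ vs" using split_list by fastforce
    with xs have "hd (us @ [w]) = y" "distinct (us @ [w])" "x \<notin> set (us @ [w])"
      by (auto simp: hd_append)
    moreover have "successively E (us @ [w])"
      using xs(4) unfolding \<open>xs = _\<close> successively_append_iff[of _ "us @ [w]"] by blast
    ultimately show ?thesis by (intro exI[of _ "us @ [w]"]) auto
  next
    case False
    with xs step show ?thesis
      by (intro exI[of _ "xs @ [w]"]) (auto simp: successively_append_iff avoiding_def)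
  qed
qed

text \<open>Two distinct neighbours joined by a simple path that misses \<open>x\<close> would close
  up with \<open>x\<close> to a cycle.\<close>

lemma avoiding_neighbours_eq:
  assumes "E x y" "E x z" "(y, z) \<in> (avoiding x)\<^sup>*"
  shows "y = z"
proof (rule ccontr)
  assume "y \<noteq> z"
  have "y \<noteq> x" using assms edge_irrefl by auto
  then obtain xs where xs: "xs \<noteq> []" "hd xs = y" "last xs = z" "successively E xs" "distinct xs"
    "x \<notin> set xs" using avoiding_path assms by blast
  then have "length xs \<ge> 2" using \<open>y \<noteq> z\<close> by (cases xs; cases "tl xs") auto
  with xs assms have "graph_cycle E (x # xs)"
    by (auto simp: graph_cycle_def successively_Cons edge_sym)
  with acyclic show False by blast
qed

text \<open>Walk from \<open>u\<close> through vertices ever closer to \<open>r\<close>. After the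
  first step the distance to \<open>r\<close> is strictly below that of \<open>x\<close>, so
  \<open>x\<close> is never met.\<close>

lemma avoiding_to_root:
  assumes "r \<in> V" "u \<in> V" "u \<noteq> x" "gdist E r u \<le> gdist E r x"
  shows "(u, r) \<in> (avoiding x)\<^sup>*"
  using assms(2-)
proof (induction "gdist E r u" arbitrary: u)
  case 0
  then show ?case using gdist_eq_0_iff assms(1) by auto
next
  case (Suc n)
  then obtain u' where u': "E u u'" "gdist E r u' = n" using gdist_pred assms(1) by metis
  with Suc have "u' \<noteq> x" by auto
  with Suc u' have "(u', r) \<in> (avoiding x)\<^sup>*" using edge_in_V by auto
  moreover have "(u, u') \<in> avoiding x" using u' Suc \<open>u' \<noteq> x\<close> by (auto simp: avoiding_def)
  ultimately show ?case by (rule converse_rtrancl_into_rtrancl[rotated])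
qed

text \<open>Both neighbours reach \<open>r\<close> without meeting \<open>x\<close>, so they are
  connected outside \<open>x\<close>. The weak inequalities also make the lemma exclude neighbours
  at equal distance from \<open>r\<close>.\<close>

lemma closer_neighbour_unique:
  assumes "r \<in> V" "E x y" "E x z" "gdist E r y \<le> gdist E r x" "gdist E r z \<le> gdist E r x"
  shows "y = z"
proof -
  have "(y, r) \<in> (avoiding x)\<^sup>*" "(z, r) \<in> (avoiding x)\<^sup>*"
    using assms edge_in_V edge_irrefl by (auto intro!: avoiding_to_root)
  then show ?thesis
    using avoiding_neighbours_eq[OF assms(2,3)] avoiding_rtrancl_sym by (metis rtrancl_trans)
qed

text \<open>A neighbour at equal distance and the predecessor of \<open>x\<close> towards
  \<open>r\<close> would be two distinct neighbours no farther from \<open>r\<close> than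
  \<open>x\<close>.\<close>

lemma gdist_edge_neq:
  assumes "r \<in> V" "E x y"
  shows "gdist E r x \<noteq> gdist E r y"
proof
  assume eq: "gdist E r x = gdist E r y"
  have V: "x \<in> V" "y \<in> V" using assms edge_in_V by auto
  show False
  proof (cases "gdist E r x")
    case 0
    with eq V assms edge_irrefl show False using gdist_eq_0_iff by metis
  next
    case (Suc n)
    then obtain x' where "E x x'" "gdist E r x' = n" using gdist_pred assms V by metis
    with closer_neighbour_unique[OF assms(1), of x x' y] assms eq Suc show False by auto
  qed
qed

lemma gdist_edge_cases:
  assumes "r \<in> V" "E x y"
  shows "gdist E r x = Suc (gdist E r y) \<or> gdist E r y = Suc (gdist E r x)"
  using gdist_edge_neq[OF assms] gdist_edge_le[OF assms] gdist_edge_le[OF assms(1) edge_sym[OF assms(2)]]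
  by linarith

end

section \<open>The level function, fathers and ancestors\<close>

context tree_rooted_at_infinity
begin

lemma ray_edge: "E (\<omega> n) (\<omega> (Suc n))"
  using gdist_walk[OF ray_in_V ray_in_V, of n "Suc n"] ray_geodesic[of n "Suc n"]
  by auto

text \<open>The level is the Busemann function of the ray. From the projection of \<open>x\<close>
  on, each step along the ray adds one to the distance from \<open>x\<close>; hence levels of
  several vertices can be compared through one common \<open>\<omega> n\<close>.\<close>

lemma level_eventually:
  assumes "x \<in> V"
  shows "\<exists>k. \<forall>n\<ge>k. level E \<omega> x = int n - int (gdist E (\<omega> n) x)"
proof -
  have "ray_proj E \<omega> x \<in> range \<omega>" and min: "\<And>y. y \<in> range \<omega> \<Longrightarrow> gdist E x (ray_proj E \<omega> x) \<le> gdist E x y"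
    using arg_min_nat_lemma[of "\<lambda>y. y \<in> range \<omega>" "\<omega> 0" "gdist E x"]
    by (auto simp: ray_proj_def arg_min_on_def)
  then obtain k where k: "ray_proj E \<omega> x = \<omega> k" by auto
  have "gdist E x (\<omega> (k + i)) = gdist E x (\<omega> k) + i \<and>
    gdist E x (\<omega> (Suc (k + i))) = gdist E x (\<omega> k) + Suc i" for i
  proof (induction i)
    case 0
    have "gdist E x (\<omega> k) \<le> gdist E x (\<omega> (Suc k))" using min k by auto
    with gdist_edge_cases[OF assms ray_edge, of k] show ?case by auto
  next
    case (Suc i)
    let ?y = "\<omega> (k + i)" and ?z = "\<omega> (Suc (k + i))" and ?w = "\<omega> (Suc (Suc (k + i)))"
    have "gdist E ?y ?w = 2" using ray_geodesic[of "k + i" "Suc (Suc (k + i))"] by simp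
    then have "?y \<noteq> ?w" by auto
    \<comment> \<open>\<open>?y\<close> is already the one neighbour of \<open>?z\<close> not
      farther from \<open>x\<close>, and the ray does not turn back.\<close>
    then have "\<not> gdist E x ?w \<le> gdist E x ?z"
      using closer_neighbour_unique[OF assms edge_sym[OF ray_edge] ray_edge, of "k + i"] Suc by auto
    with gdist_edge_cases[OF assms ray_edge, of "Suc (k + i)"] Suc show ?case by auto
  qed
  then have far: "gdist E (\<omega> (k + i)) x = gdist E (\<omega> k) x + i" for i
    using gdist_sym by metis
  have "level E \<omega> x = int n - int (gdist E (\<omega> n) x)" if "n \<ge> k" for n
    using far[of "n - k"] that ray_geodesic[of 0 k] by (simp add: level_def k)
  then show ?thesis by blast
qed

lemma level_edge:
  assumes "E x y"
  shows "level E \<omega> y = level E \<omega> x + 1 \<or> level E \<omega> y = level E \<omega> x - 1"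
proof -
  obtain k l where "\<forall>n\<ge>k. level E \<omega> x = int n - int (gdist E (\<omega> n) x)"
    "\<forall>n\<ge>l. level E \<omega> y = int n - int (gdist E (\<omega> n) y)"
    using level_eventually edge_in_V[OF assms] by meson
  then have "level E \<omega> x = int (max k l) - int (gdist E (\<omega> (max k l)) x)"
    "level E \<omega> y = int (max k l) - int (gdist E (\<omega> (max k l)) y)" by auto
  with gdist_edge_cases[OF ray_in_V assms, of "max k l"] show ?thesis by linarith
qed

lemma level_relpowp: "(E ^^ n) x y \<Longrightarrow> \<bar>level E \<omega> x - level E \<omega> y\<bar> \<le> int n"
proof (induction n arbitrary: y)
  case (Suc n)
  then obtain z where "(E ^^ n) x z" "E z y" by auto
  with Suc.IH[of z] level_edge[of z y] show ?case by auto
qed simp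

text \<open>The father is the neighbour closer to \<open>\<omega> n\<close> for large
  \<open>n\<close>, and a tree allows only one such neighbour.\<close>

lemma father_ex1:
  assumes "x \<in> V"
  shows "\<exists>!y. E x y \<and> level E \<omega> y = level E \<omega> x + 1"
proof (rule ex_ex1I)
  obtain k where k: "\<And>n. n \<ge> k \<Longrightarrow> level E \<omega> x = int n - int (gdist E (\<omega> n) x)"
    using level_eventually[OF assms] by blast
  \<comment> \<open>The second argument of \<open>max\<close> makes \<open>\<omega> n\<close> differ
    from \<open>x\<close>, so that some neighbour of \<open>x\<close> is closer to it.\<close>
  define n where "n = max k (nat (level E \<omega> x + 1))"
  have "k \<le> n" by (simp add: n_def)
  have "gdist E (\<omega> n) x \<noteq> 0" using k[of n] by (auto simp: n_def)
  then obtain d where d: "gdist E (\<omega> n) x = Suc d" by (cases "gdist E (\<omega> n) x") auto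
  have *: "gdist E (\<omega> (n + i)) x = Suc d + i" for i
    using k[of n] k[of "n + i"] d \<open>k \<le> n\<close> by simp
  obtain y where y: "E x y" "gdist E (\<omega> n) y = d" using gdist_pred[OF ray_in_V assms d] .
  obtain l where l: "\<And>n. n \<ge> l \<Longrightarrow> level E \<omega> y = int n - int (gdist E (\<omega> n) y)"
    using level_eventually edge_in_V y by meson
  \<comment> \<open>A step along the ray adds at most one to the distance from \<open>y\<close> but
    exactly one to that from \<open>x\<close>, so \<open>y\<close> stays the closer of the
    two.\<close>
  have "gdist E (\<omega> (n + i)) y \<le> d + i" for i
  proof (induction i)
    case (Suc i)
    have "gdist E y (\<omega> (Suc (n + i))) \<le> Suc (gdist E y (\<omega> (n + i)))"
      using edge_in_V y ray_edge by (intro gdist_edge_le) auto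
    with Suc show ?case by (simp add: gdist_sym)
  qed (simp add: y)
  from this[of l] l[of "n + l"] k[of "n + l"] *[of l] level_edge[OF y(1)]
  have "level E \<omega> y = level E \<omega> x + 1" using \<open>k \<le> n\<close> by simp
  with y show "\<exists>y. E x y \<and> level E \<omega> y = level E \<omega> x + 1" by blast
next
  fix y z
  assume yz: "E x y \<and> level E \<omega> y = level E \<omega> x + 1" "E x z \<and> level E \<omega> z = level E \<omega> x + 1"
  then have V: "y \<in> V" "z \<in> V" using edge_in_V by auto
  obtain k l j where "\<forall>n\<ge>k. level E \<omega> x = int n - int (gdist E (\<omega> n) x)"
    "\<forall>n\<ge>l. level E \<omega> y = int n - int (gdist E (\<omega> n) y)"
    "\<forall>n\<ge>j. level E \<omega> z = int n - int (gdist E (\<omega> n) z)"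
    using level_eventually assms V by meson
  moreover define n where "n = k + l + j"
  then have "k \<le> n" "l \<le> n" "j \<le> n" by auto
  ultimately have "level E \<omega> x = int n - int (gdist E (\<omega> n) x)"
    "level E \<omega> y = int n - int (gdist E (\<omega> n) y)"
    "level E \<omega> z = int n - int (gdist E (\<omega> n) z)" by blast+
  with yz closer_neighbour_unique[OF ray_in_V, of x y z n] show "y = z" by auto
qed

definition father :: "'a \<Rightarrow> 'a" where
  "father x = (THE y. E x y \<and> level E \<omega> y = level E \<omega> x + 1)"

lemma
  assumes "x \<in> V"
  shows father_edge: "E x (father x)"
    and level_father: "level E \<omega> (father x) = level E \<omega> x + 1"
  using theI'[OF father_ex1[OF assms]] by (simp_all add: father_def)

lemma father_eqI: "E x y \<Longrightarrow> level E \<omega> y = level E \<omega> x + 1 \<Longrightarrow> father x = y"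
  unfolding father_def by (rule the1_equality[OF father_ex1]) (simp_all add: edge_in_V)

lemma edge_father: "E x y \<Longrightarrow> y = father x \<or> x = father y"
  using level_edge[of x y] father_eqI[of x y] father_eqI[of y x] edge_sym by force

lemma sons_iff: "x \<in> V \<Longrightarrow> y \<in> sons E \<omega> x \<longleftrightarrow> y \<in> V \<and> father y = x"
  using father_eqI[of y x] father_edge[of y] level_father[of y] edge_in_V[of x y] edge_sym
  by (auto simp: sons_def)

lemma father_in_V: "x \<in> V \<Longrightarrow> father x \<in> V"
  using father_edge edge_in_V by blast

lemma funpow_father_in_V: "x \<in> V \<Longrightarrow> (father ^^ n) x \<in> V"
  by (induction n) (auto simp: father_in_V)

lemma level_funpow_father: "x \<in> V \<Longrightarrow> level E \<omega> ((father ^^ n) x) = level E \<omega> x + int n"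
  by (induction n) (auto simp: level_father funpow_father_in_V)

lemma funpow_father_inj: "x \<in> V \<Longrightarrow> (father ^^ i) x = (father ^^ j) x \<longleftrightarrow> i = j"
  by (metis level_funpow_father add_left_cancel of_nat_eq_iff)

lemma relpowp_funpow_father: "x \<in> V \<Longrightarrow> (E ^^ n) x ((father ^^ n) x)"
  by (induction n) (auto simp: father_edge funpow_father_in_V)

text \<open>The level changes by one along each edge, so climbing \<open>n\<close> levels takes at
  least \<open>n\<close> edges.\<close>

lemma gdist_funpow_father:
  assumes "x \<in> V"
  shows "gdist E x ((father ^^ n) x) = n"
proof (rule antisym)
  show "gdist E x ((father ^^ n) x) \<le> n" using relpowp_funpow_father gdist_le assms by metis
  have "(E ^^ gdist E x ((father ^^ n) x)) x ((father ^^ n) x)"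
    using assms gdist_walk funpow_father_in_V by blast
  from level_relpowp[OF this] level_funpow_father[OF assms]
  show "n \<le> gdist E x ((father ^^ n) x)" by simp
qed

text \<open>A walk is straightened to a climb of \<open>b\<close> steps from \<open>x\<close>
  followed by a descent of \<open>a\<close> steps to \<open>y\<close>. Each further edge lengthens
  the descent, lengthens the climb when there is no descent, or cancels the last step of the
  descent.\<close>

lemma relpowp_common_ancestor:
  assumes "x \<in> V" "(E ^^ n) x y"
  shows "\<exists>a b. a + b \<le> n \<and> (father ^^ a) y = (father ^^ b) x"
  using assms(2)
proof (induction n arbitrary: y)
  case 0
  then show ?case by auto
next
  case (Suc n)
  then obtain z where z: "(E ^^ n) x z" "E z y" by auto
  with Suc.IH obtain a b where ab: "a + b \<le> n" "(father ^^ a) z = (father ^^ b) x" by blast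
  consider "z = father y" | "y = father z" "a = 0" | a' where "y = father z" "a = Suc a'"
    using edge_father[OF z(2)] by (cases a) auto
  then show ?case
  proof cases
    case 1
    with ab show ?thesis by (intro exI[of _ "Suc a"] exI[of _ b]) (simp add: funpow_swap1)
  next
    case 2
    with ab show ?thesis by (intro exI[of _ 0] exI[of _ "Suc b"]) simp
  next
    case 3
    with ab show ?thesis by (intro exI[of _ a'] exI[of _ b]) (simp add: funpow_swap1)
  qed
qed

text \<open>The common ancestor lies \<open>b \<le> r\<close> generations above \<open>x\<close>;
  lifting it by \<open>r - b\<close> more gives the same vertex for the whole ball.\<close>

lemma gball_ancestor:
  assumes "x \<in> V" "y \<in> gball V E x r"
  shows "\<exists>j\<le>2 * r. (father ^^ j) y = (father ^^ r) x"
proof -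
  have "y \<in> V" "gdist E x y \<le> r" using assms by (auto simp: gball_def)
  then obtain a b where ab: "a + b \<le> r" "(father ^^ a) y = (father ^^ b) x"
    using relpowp_common_ancestor[OF assms(1) gdist_walk[OF assms(1)]] le_trans by metis
  have "(father ^^ ((r - b) + a)) y = (father ^^ ((r - b) + b)) x"
    by (simp only: funpow_add o_apply ab(2))
  with ab show ?thesis by (intro exI[of _ "r - b + a"]) auto
qed

lemma funpow_father_in_gball: "x \<in> V \<Longrightarrow> n \<le> r \<Longrightarrow> (father ^^ n) x \<in> gball V E x r"
  by (simp add: gball_def gdist_funpow_father funpow_father_in_V)

end

section \<open>Mass of balls under a flow measure\<close>

text \<open>Estimates of masses, from above and from below, thus reduce to real sums over finite
  subsets.\<close>

lemma mass_eq_SUP: "mass m A = (SUP F\<in>{F. finite F \<and> F \<subseteq> A}. \<Sum>x\<in>F. ennreal (m x))"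
  unfolding mass_def by (rule nonneg_infsum_complete) simp

lemma mass_le:
  assumes "\<And>x. x \<in> A \<Longrightarrow> 0 \<le> m x" "\<And>F. finite F \<Longrightarrow> F \<subseteq> A \<Longrightarrow> sum m F \<le> B"
  shows "mass m A \<le> ennreal B"
proof -
  have "(SUP F\<in>{F. finite F \<and> F \<subseteq> A}. \<Sum>x\<in>F. ennreal (m x)) \<le> ennreal B"
  proof (rule SUP_least)
    fix F assume "F \<in> {F. finite F \<and> F \<subseteq> A}"
    with assms show "(\<Sum>x\<in>F. ennreal (m x)) \<le> ennreal B"
      by (subst sum_ennreal) (auto intro: ennreal_leI)
  qed
  then show ?thesis unfolding mass_eq_SUP .
qed

lemma sum_le_mass:
  assumes "finite F" "F \<subseteq> A" "\<And>x. x \<in> A \<Longrightarrow> 0 \<le> m x"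
  shows "ennreal (sum m F) \<le> mass m A"
proof -
  have "(\<Sum>x\<in>F. ennreal (m x)) = ennreal (sum m F)"
    using assms by (intro sum_ennreal) auto
  moreover have "F \<in> {F. finite F \<and> F \<subseteq> A}" using assms by simp
  ultimately show ?thesis unfolding mass_eq_SUP by (metis (mono_tags, lifting) SUP_upper)
qed

text \<open>A common bound for the finite subsets also forces \<open>A\<close> to be finite.\<close>

lemma ecard_leI:
  assumes "\<And>F. finite F \<Longrightarrow> F \<subseteq> A \<Longrightarrow> card F \<le> k"
  shows "ecard A \<le> enat k"
proof -
  have "finite A"
    using assms infinite_arbitrarily_large[of A "Suc k"] by (metis Suc_n_not_le_n)
  with assms show ?thesis by (auto simp: ecard_def)
qed

lemma ecard_le_enatD: "ecard A \<le> enat k \<Longrightarrow> finite A \<and> card A \<le> k"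
  by (auto simp: ecard_def split: if_splits)

lemma ecard_ge_2_other:
  assumes "2 \<le> ecard A"
  obtains z where "z \<in> A" "z \<noteq> y"
proof -
  have "\<not> A \<subseteq> {y}"
  proof
    assume "A \<subseteq> {y}"
    then have "finite A" "card A \<le> 1"
      using finite_subset card_mono[of "{y}" A] by auto
    with assms show False by (auto simp: ecard_def numeral_eq_enat)
  qed
  with that show thesis by blast
qed

context tree_rooted_at_infinity
begin

lemma flow_measure_pos: "flow_measure V E \<omega> m \<Longrightarrow> x \<in> V \<Longrightarrow> 0 < m x"
  by (simp add: flow_measure_def)

lemma flow_measure_sum_sons_le:
  assumes m: "flow_measure V E \<omega> m" and "x \<in> V" "finite F" "F \<subseteq> sons E \<omega> x"
  shows "sum m F \<le> m x"
proof (rule finite_sum_le_has_sum)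
  show "(m has_sum m x) (sons E \<omega> x)" using assms by (simp add: flow_measure_def)
  show "0 \<le> m y" if "y \<in> sons E \<omega> x - F" for y
    using that flow_measure_pos[OF m] sons_iff[OF \<open>x \<in> V\<close>] by (auto intro: less_imp_le)
qed fact+

lemma flow_measure_le_funpow_father:
  assumes m: "flow_measure V E \<omega> m" and "x \<in> V"
  shows "m x \<le> m ((father ^^ n) x)"
proof (induction n)
  case (Suc n)
  let ?y = "(father ^^ n) x"
  have "sum m {?y} \<le> m (father ?y)"
    using assms by (intro flow_measure_sum_sons_le) (auto simp: sons_iff father_in_V funpow_father_in_V)
  with Suc show ?case by simp
qed simp

text \<open>Group \<open>F\<close> by fathers: each group has at most the mass of its father, and
  the fathers lie one generation closer to \<open>x\<close>.\<close>

lemma flow_measure_sum_descendants_le: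
  assumes m: "flow_measure V E \<omega> m" and "x \<in> V" "finite F" "F \<subseteq> V"
    and "\<And>y. y \<in> F \<Longrightarrow> (father ^^ n) y = x"
  shows "sum m F \<le> m x"
  using assms(3-)
proof (induction n arbitrary: F)
  case 0
  then have "F \<subseteq> {x}" by auto
  then have "sum m F \<le> sum m {x}"
    using flow_measure_pos[OF m \<open>x \<in> V\<close>] by (intro sum_mono2) auto
  then show ?case by simp
next
  case (Suc n)
  have "sum m F = (\<Sum>u\<in>father ` F. sum m {y \<in> F. father y = u})"
    using Suc.prems by (intro sum.image_gen)
  also have "\<dots> \<le> sum m (father ` F)"
  proof (rule sum_mono)
    fix u assume "u \<in> father ` F"
    with Suc.prems have "u \<in> V" by (auto simp: father_in_V)
    with Suc.prems show "sum m {y \<in> F. father y = u} \<le> m u"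
      by (intro flow_measure_sum_sons_le[OF m]) (auto simp: sons_iff)
  qed
  also have "\<dots> \<le> m x"
    using Suc.prems by (intro Suc.IH) (auto simp: father_in_V funpow_swap1)
  finally show ?case .
qed

lemma mass_gball_le:
  assumes m: "flow_measure V E \<omega> m" and "x \<in> V"
  shows "mass m (gball V E x r) \<le> ennreal (real (2 * r + 1) * m ((father ^^ r) x))"
proof (rule mass_le)
  have pos: "0 \<le> m y" if "y \<in> V" for y
    using flow_measure_pos[OF m that] by simp
  then show "0 \<le> m y" if "y \<in> gball V E x r" for y
    using that by (simp add: gball_def)
  fix F assume F: "finite F" "F \<subseteq> gball V E x r"
  then have FV: "F \<subseteq> V" by (auto simp: gball_def)
  let ?z = "(father ^^ r) x"
  \<comment> \<open>The generations below \<open>?z\<close>, pairwise disjoint because ancestors of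
    different orders are distinct; their number is the factor \<open>2 * r + 1\<close>.\<close>
  let ?G = "\<lambda>j. {y \<in> F. (father ^^ j) y = ?z}"
  have "y \<in> (\<Union>j\<le>2 * r. ?G j)" if "y \<in> F" for y
    using gball_ancestor[OF \<open>x \<in> V\<close> subsetD[OF F(2) that]] that by auto
  then have "sum m F = sum m (\<Union>j\<le>2 * r. ?G j)" by (intro sum.cong) auto
  also have "\<dots> = (\<Sum>j\<le>2 * r. sum m (?G j))"
  proof (rule sum.UNION_disjoint)
    show "\<forall>i\<in>{..2 * r}. \<forall>j\<in>{..2 * r}. i \<noteq> j \<longrightarrow> ?G i \<inter> ?G j = {}"
    proof (intro ballI impI equals0I)
      fix i j y assume "i \<noteq> j" "y \<in> ?G i \<inter> ?G j"
      then show False using FV funpow_father_inj[of y i j] by auto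
    qed
  qed (use F in auto)
  also have "\<dots> \<le> (\<Sum>j\<le>2 * r. m ?z)"
    using F FV \<open>x \<in> V\<close>
    by (intro sum_mono flow_measure_sum_descendants_le[OF m]) (auto simp: funpow_father_in_V)
  finally show "sum m F \<le> real (2 * r + 1) * m ?z" by simp
qed

lemma mass_gball_ge:
  assumes m: "flow_measure V E \<omega> m" and "x \<in> V"
  shows "ennreal (\<Sum>j\<le>r. m ((father ^^ j) x)) \<le> mass m (gball V E x r)"
proof -
  have "inj_on (\<lambda>j. (father ^^ j) x) {..r}"
    by (rule inj_onI) (simp add: funpow_father_inj \<open>x \<in> V\<close>)
  then have "(\<Sum>j\<le>r. m ((father ^^ j) x)) = sum m ((\<lambda>j. (father ^^ j) x) ` {..r})"
    by (simp add: sum.reindex)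
  also have "ennreal \<dots> \<le> mass m (gball V E x r)"
    using \<open>x \<in> V\<close> flow_measure_pos[OF m] funpow_father_in_gball
    by (intro sum_le_mass) (auto simp: gball_def intro: less_imp_le)
  finally show ?thesis .
qed

section \<open>Branching along geodesics for a doubling flow\<close>

lemma descendant_exists:
  assumes no_leaves: "\<forall>x\<in>V. sons E \<omega> x \<noteq> {}" and "x \<in> V"
  shows "\<exists>y\<in>V. (father ^^ n) y = x"
proof (induction n)
  case (Suc n)
  then obtain y where y: "y \<in> V" "(father ^^ n) y = x" by blast
  with no_leaves obtain z where "z \<in> sons E \<omega> y" by blast
  with y show ?case by (intro bexI[of _ z]) (auto simp: sons_iff funpow_swap1)
qed (use \<open>x \<in> V\<close> in auto)

text \<open>
  A ball of radius \<open>2 n\<close> around a descendant of \<open>x\<close> of depth \<open>2 n\<close> consists of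
  descendants of \<open>x\<close>, whereas the ball of twice the radius contains the ancestors of \<open>x\<close>
  of order \<open>n, \<dots>, 2 n\<close>.
\<close>

lemma doubling_flow_measure_ancestor_le:
  assumes no_leaves: "\<forall>x\<in>V. sons E \<omega> x \<noteq> {}" and m: "flow_measure V E \<omega> m"
    and C: "C > 1" "\<forall>x\<in>V. \<forall>r::nat. r > 0 \<longrightarrow>
      mass m (gball V E x (2 * r)) \<le> ennreal C * mass m (gball V E x r)"
    and "x \<in> V"
  shows "m ((father ^^ n) x) \<le> 4 * C * m x"
\<comment> \<open>Doubling will be applied at radius \<open>2 * n\<close>, which has to be
  positive.\<close>
proof (cases "n = 0")
  case True
  with C flow_measure_pos[OF m \<open>x \<in> V\<close>] show ?thesis by simp
next
  case False
  obtain y where y: "y \<in> V" "(father ^^ (2 * n)) y = x"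
    using descendant_exists[OF no_leaves \<open>x \<in> V\<close>] by blast
  let ?z = "(father ^^ n) x"
  have pos: "0 < m x" "0 < m ?z"
    using flow_measure_pos[OF m] \<open>x \<in> V\<close> funpow_father_in_V by auto
  have anc: "m ?z \<le> m ((father ^^ j) y)" if j: "j \<in> {3 * n..4 * n}" for j
  proof -
    \<comment> \<open>Order \<open>j\<close> above \<open>y\<close> is order
      \<open>j - 2 * n \<ge> n\<close> above \<open>x\<close>, hence at or above
      \<open>?z\<close>.\<close>
    have "(father ^^ j) y = (father ^^ (j - 3 * n)) ((father ^^ n) ((father ^^ (2 * n)) y))"
      using j by (simp flip: funpow_add[THEN fun_cong, unfolded o_apply])
    then show ?thesis
      using flow_measure_le_funpow_father[OF m funpow_father_in_V[OF \<open>x \<in> V\<close>], of n "j - 3 * n"] y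
      by simp
  qed
  have "real (n + 1) * m ?z = (\<Sum>j\<in>{3 * n..4 * n}. m ?z)" by simp
  also have "\<dots> \<le> (\<Sum>j\<in>{3 * n..4 * n}. m ((father ^^ j) y))"
    using anc by (rule sum_mono)
  also have "\<dots> \<le> (\<Sum>j\<le>2 * (2 * n). m ((father ^^ j) y))"
    using flow_measure_pos[OF m funpow_father_in_V[OF y(1)]]
    by (intro sum_mono2) (auto intro: less_imp_le)
  finally have "ennreal (real (n + 1) * m ?z) \<le> ennreal (\<Sum>j\<le>2 * (2 * n). m ((father ^^ j) y))"
    by (rule ennreal_leI)
  also have "\<dots> \<le> mass m (gball V E y (2 * (2 * n)))" by (rule mass_gball_ge[OF m y(1)])
  also have "\<dots> \<le> ennreal C * mass m (gball V E y (2 * n))"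
    using C(2)[rule_format, OF y(1), of "2 * n"] False by simp
  also have "\<dots> \<le> ennreal C * ennreal (real (2 * (2 * n) + 1) * m x)"
    using mass_gball_le[OF m y(1), of "2 * n"] y by (intro mult_left_mono) auto
  also have "\<dots> = ennreal (C * (real (2 * (2 * n) + 1) * m x))"
    using C by (simp add: ennreal_mult')
  finally have "real (n + 1) * m ?z \<le> C * (real (2 * (2 * n) + 1) * m x)"
    using C pos by (subst (asm) ennreal_le_iff) auto
  \<comment> \<open>\<open>4 * n + 1 \<le> 4 * (n + 1)\<close> lets the factor \<open>n + 1\<close>
    cancel and leaves the 4.\<close>
  also have "\<dots> \<le> C * (real (4 * (n + 1)) * m x)"
    using C pos by (intro mult_left_mono mult_right_mono) auto
  finally have "real (n + 1) * m ?z \<le> real (n + 1) * (4 * C * m x)"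
    by (simp add: algebra_simps)
  then show ?thesis by simp
qed

text \<open>Every son carries at least \<open>m x / K\<close>, while all sons in \<open>F\<close>
  together carry at most \<open>m x\<close>.\<close>

lemma card_sons_le:
  assumes m: "flow_measure V E \<omega> m" and K: "\<And>y. y \<in> V \<Longrightarrow> m (father y) \<le> K * m y"
    and "x \<in> V" "finite F" "F \<subseteq> sons E \<omega> x"
  shows "real (card F) \<le> K"
proof -
  have "real (card F) * m x = (\<Sum>y\<in>F. m x)" by simp
  also have "\<dots> \<le> (\<Sum>y\<in>F. K * m y)"
  proof (rule sum_mono)
    fix y assume "y \<in> F"
    then have "y \<in> V" "father y = x" using assms(5) sons_iff[OF \<open>x \<in> V\<close>] by auto
    then show "m x \<le> K * m y" using K by blast
  qed
  also have "\<dots> = K * sum m F" by (simp add: sum_distrib_left)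
  also have "\<dots> \<le> K * m x"
  proof (rule mult_left_mono)
    show "sum m F \<le> m x" by (rule flow_measure_sum_sons_le[OF m]) fact+
    show "0 \<le> K"
      using K[OF \<open>x \<in> V\<close>] flow_measure_pos[OF m \<open>x \<in> V\<close>]
        flow_measure_pos[OF m father_in_V[OF \<open>x \<in> V\<close>]]
      by (meson less_le_trans less_imp_le zero_less_mult_pos2)
  qed
  finally show ?thesis using flow_measure_pos[OF m \<open>x \<in> V\<close>] by simp
qed

definition branching :: "'a \<Rightarrow> bool" where
  "branching x \<longleftrightarrow> 2 \<le> num_sons E \<omega> x"

text \<open>Orders are counted from \<open>Suc j\<close>, since branching at \<open>x\<close> itself
  only splits the flow below \<open>x\<close> and adds nothing above it.\<close>

lemma flow_measure_branching_ancestors: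
  assumes m: "flow_measure V E \<omega> m" and K: "K > 0" "\<And>y. y \<in> V \<Longrightarrow> m (father y) \<le> K * m y"
    and "x \<in> V"
  shows "m x + real (card {j. j < n \<and> branching ((father ^^ Suc j) x)}) * (m x / K)
    \<le> m ((father ^^ n) x)"
proof (induction n)
  case (Suc n)
  let ?y = "(father ^^ n) x" and ?J = "\<lambda>n. {j. j < n \<and> branching ((father ^^ Suc j) x)}"
  have yV: "?y \<in> V" "father ?y \<in> V" using \<open>x \<in> V\<close> funpow_father_in_V father_in_V by auto
  show ?case
  proof (cases "branching (father ?y)")
    case True
    then obtain s where s: "s \<in> sons E \<omega> (father ?y)" "s \<noteq> ?y"
      unfolding branching_def num_sons_def by (rule ecard_ge_2_other)
    have sV: "s \<in> V" "father s = father ?y" using s yV by (auto simp: sons_iff)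
    have "sum m {s, ?y} \<le> m (father ?y)"
      using s yV by (intro flow_measure_sum_sons_le[OF m]) (auto simp: sons_iff)
    with s have "m s + m ?y \<le> m (father ?y)" by simp
    \<comment> \<open>The father of the sibling \<open>s\<close> is an ancestor of \<open>x\<close>,
      so it carries at least \<open>m x\<close>, and \<open>s\<close> at least the fraction
      \<open>1 / K\<close> of that.\<close>
    moreover have "m x \<le> K * m s"
      using flow_measure_le_funpow_father[OF m \<open>x \<in> V\<close>, of "Suc n"] K(2)[OF sV(1)] sV by simp
    then have "m x / K \<le> m s" using K by (simp add: field_simps)
    moreover have "?J (Suc n) = insert n (?J n)"
      using True by (auto simp: less_Suc_eq)
    then have "card (?J (Suc n)) = Suc (card (?J n))" by simp
    ultimately show ?thesis using Suc.IH by (simp add: algebra_simps add_divide_distrib)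
  next
    case False
    then have "?J (Suc n) = ?J n" by (auto simp: less_Suc_eq)
    moreover have "m ?y \<le> m (father ?y)"
      using flow_measure_le_funpow_father[OF m yV(1), of 1] by simp
    ultimately show ?thesis using Suc.IH by simp
  qed
qed simp

text \<open>If \<open>c\<close> proper ancestors up to some order branch, then
  \<open>m x * (1 + c / K) \<le> K * m x\<close>, which gives \<open>c \<le> K\<^sup>2\<close>. The
  additional 1 stands for \<open>x\<close>, which may itself lie in \<open>F\<close>.\<close>

lemma card_branching_ancestors_le:
  assumes m: "flow_measure V E \<omega> m" and K: "K > 0" "\<And>y n. y \<in> V \<Longrightarrow> m ((father ^^ n) y) \<le> K * m y"
    and "x \<in> V" "finite F" "F \<subseteq> range (\<lambda>j. (father ^^ j) x)" "\<And>y. y \<in> F \<Longrightarrow> branching y"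
  shows "real (card F) \<le> K\<^sup>2 + 1"
proof -
  obtain J where J: "finite J" "F = (\<lambda>j. (father ^^ j) x) ` J"
    using finite_subset_image[OF assms(5,6)] by auto
  obtain n where n: "\<And>j. j \<in> J \<Longrightarrow> j \<le> n" using J(1) finite_nat_set_iff_bounded_le by auto
  let ?J = "{j. j < n \<and> branching ((father ^^ Suc j) x)}"
  have "F \<subseteq> insert x ((\<lambda>j. (father ^^ Suc j) x) ` ?J)"
  proof
    fix y assume y: "y \<in> F"
    then obtain j where j: "j \<in> J" "y = (father ^^ j) x" using J by auto
    show "y \<in> insert x ((\<lambda>j. (father ^^ Suc j) x) ` ?J)"
    proof (cases j)
      case 0
      with j show ?thesis by simp
    next
      case (Suc i)
      with j n[OF j(1)] assms(7)[OF y] have "i \<in> ?J" by simp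
      with j Suc show ?thesis by blast
    qed
  qed
  then have "card F \<le> card (insert x ((\<lambda>j. (father ^^ Suc j) x) ` ?J))"
    by (intro card_mono) auto
  also have "\<dots> \<le> Suc (card ((\<lambda>j. (father ^^ Suc j) x) ` ?J))" by (rule card_insert_le_m1) auto
  also have "\<dots> \<le> Suc (card ?J)" by (simp add: card_image_le)
  finally have "real (card F) \<le> real (card ?J) + 1" by simp
  moreover have "m x + real (card ?J) * (m x / K) \<le> K * m x"
    using flow_measure_branching_ancestors[OF m K(1) _ \<open>x \<in> V\<close>, of n] K(2)[of _ 1]
      K(2)[OF \<open>x \<in> V\<close>, of n] by fastforce
  then have "m x * (1 + real (card ?J) / K) \<le> m x * K" by (simp add: algebra_simps)
  then have "1 + real (card ?J) / K \<le> K"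
    using flow_measure_pos[OF m \<open>x \<in> V\<close>] by simp
  then have "real (card ?J) / K \<le> K" by simp
  then have "real (card ?J) \<le> K\<^sup>2" using K(1) by (simp add: field_simps power2_eq_square)
  ultimately show ?thesis by simp
qed

text \<open>A path that has gone down once never climbs again, since climbing would lead back to the
  father it has just left.\<close>

lemma descending_path:
  assumes edge: "\<And>k. k < n \<Longrightarrow> E (f k) (f (Suc k))"
    and nb: "\<And>k. Suc k < n \<Longrightarrow> f k \<noteq> f (Suc (Suc k))"
    and start: "f 0 = father (f (Suc 0))" and "k \<le> n"
  shows "(father ^^ k) (f k) = f 0"
proof -
  have down: "f k = father (f (Suc k))" if "k < n" for k
    using that
  proof (induction k)
    case (Suc k)
    then have "father (f (Suc k)) = f k" by simp
    with nb[of k] edge[of "Suc k"] edge_father Suc.prems show ?case by metis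
  qed (use start in simp)
  from \<open>k \<le> n\<close> show ?thesis
  proof (induction k)
    case (Suc k)
    with down[of k] show ?case by (simp add: funpow_swap1)
  qed simp
qed

text \<open>Of the two neighbours of an inner vertex on the segment, at least one is not its father
  and so is its son; in that direction the segment descends all the way to its end.\<close>

lemma geodesic_segment_ancestor:
  assumes V: "\<gamma> ` {a..b} \<subseteq> V"
    and dist: "\<And>i j. i \<in> {a..b} \<Longrightarrow> j \<in> {a..b} \<Longrightarrow> int (gdist E (\<gamma> i) (\<gamma> j)) = \<bar>i - j\<bar>"
    and i: "i \<in> {a..b}"
  shows "\<gamma> i \<in> range (\<lambda>j. (father ^^ j) (\<gamma> a)) \<union> range (\<lambda>j. (father ^^ j) (\<gamma> b))"
proof -
  have edge: "E (\<gamma> j) (\<gamma> k)" if "j \<in> {a..b}" "k \<in> {a..b}" "\<bar>j - k\<bar> = 1" for j k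
  proof -
    have "gdist E (\<gamma> j) (\<gamma> k) = 1" using dist[OF that(1,2)] that(3) by simp
    moreover have "(E ^^ gdist E (\<gamma> j) (\<gamma> k)) (\<gamma> j) (\<gamma> k)"
      using that V by (intro gdist_walk) auto
    ultimately show ?thesis by auto
  qed
  have neq: "\<gamma> j \<noteq> \<gamma> k" if "j \<in> {a..b}" "k \<in> {a..b}" "j \<noteq> k" for j k
  proof
    assume "\<gamma> j = \<gamma> k"
    with dist[OF that(1,2)] that(3) show False by simp
  qed
  have inner: "i = a \<or> i = b \<or> \<gamma> i = father (\<gamma> (i + 1)) \<or> \<gamma> i = father (\<gamma> (i - 1))"
  proof (rule ccontr)
    assume "\<not> ?thesis"
    moreover from this i have "E (\<gamma> i) (\<gamma> (i + 1))" "E (\<gamma> i) (\<gamma> (i - 1))" by (auto intro!: edge)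
    ultimately have "\<gamma> (i + 1) = \<gamma> (i - 1)" using edge_father by metis
    moreover have "i + 1 \<in> {a..b}" "i - 1 \<in> {a..b}" using \<open>\<not> _\<close> i by auto
    ultimately show False using neq[of "i + 1" "i - 1"] by simp
  qed
  have self: "x \<in> range (\<lambda>j. (father ^^ j) x)" for x by (rule range_eqI[of _ _ 0]) simp
  consider "i = a" | "i = b" | "i < b" "\<gamma> i = father (\<gamma> (i + 1))"
    | "a < i" "\<gamma> i = father (\<gamma> (i - 1))"
    using inner i by force
  then show ?thesis
  proof cases
    case 3
    define n where "n = nat (b - i)"
    have "(father ^^ n) (\<gamma> (i + int n)) = \<gamma> (i + int 0)"
    proof (rule descending_path[of n "\<lambda>k. \<gamma> (i + int k)"])
      show "E (\<gamma> (i + int k)) (\<gamma> (i + int (Suc k)))" if "k < n" for k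
        using i that by (intro edge) (auto simp: n_def)
      show "\<gamma> (i + int k) \<noteq> \<gamma> (i + int (Suc (Suc k)))" if "Suc k < n" for k
        using i that by (intro neq) (auto simp: n_def)
    qed (use 3 in auto)
    with 3 have "\<gamma> i = (father ^^ n) (\<gamma> b)" by (simp add: n_def)
    then show ?thesis by blast
  next
    case 4
    define n where "n = nat (i - a)"
    have "(father ^^ n) (\<gamma> (i - int n)) = \<gamma> (i - int 0)"
    proof (rule descending_path[of n "\<lambda>k. \<gamma> (i - int k)"])
      show "E (\<gamma> (i - int k)) (\<gamma> (i - int (Suc k)))" if "k < n" for k
        using i that by (intro edge) (auto simp: n_def)
      show "\<gamma> (i - int k) \<noteq> \<gamma> (i - int (Suc (Suc k)))" if "Suc k < n" for k
        using i that by (intro neq) (auto simp: n_def)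
    qed (use 4 in auto)
    with 4 have "\<gamma> i = (father ^^ n) (\<gamma> a)" by (simp add: n_def)
    then show ?thesis by blast
  qed (use self in auto)
qed

text \<open>Finitely many branching vertices of a geodesic, even of an infinite one, lie in a finite
  segment, and the ancestors of each of its two ends account for at most \<open>k\<close> of
  them.\<close>

lemma num_branching_geodesic_le:
  assumes bound: "\<And>x F. x \<in> V \<Longrightarrow> finite F \<Longrightarrow> F \<subseteq> range (\<lambda>j. (father ^^ j) x) \<Longrightarrow>
      (\<And>y. y \<in> F \<Longrightarrow> branching y) \<Longrightarrow> card F \<le> k"
    and g: "g \<in> geodesics V E"
  shows "num_branching E \<omega> g \<le> enat (2 * k)"
  unfolding num_branching_def
proof (rule ecard_leI)
  obtain \<gamma> :: "int \<Rightarrow> 'a" and I where g: "g = \<gamma> ` I"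
    and I: "\<forall>i\<in>I. \<forall>j\<in>I. {i..j} \<subseteq> I" "\<gamma> ` I \<subseteq> V"
      "\<forall>i\<in>I. \<forall>j\<in>I. int (gdist E (\<gamma> i) (\<gamma> j)) = \<bar>i - j\<bar>"
    using g unfolding geodesics_def by blast
  fix F assume F: "finite F" "F \<subseteq> {y \<in> g. 2 \<le> num_sons E \<omega> y}"
  then obtain J where J: "finite J" "J \<subseteq> I" "F = \<gamma> ` J"
    using g finite_subset_image[of F \<gamma> I] by auto
  show "card F \<le> 2 * k"
  proof (cases "J = {}")
    case False
    define a b where "a = Min J" and "b = Max J"
    have "a \<in> J" "b \<in> J" and ab: "J \<subseteq> {a..b}"
      using False J(1) by (auto simp: a_def b_def)
    then have sub: "{a..b} \<subseteq> I" and V: "\<gamma> a \<in> V" "\<gamma> b \<in> V" using I J(2) by blast+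
    let ?A = "\<lambda>x. F \<inter> range (\<lambda>j. (father ^^ j) x)"
    have "\<gamma> i \<in> ?A (\<gamma> a) \<union> ?A (\<gamma> b)" if "i \<in> J" for i
      using geodesic_segment_ancestor[of \<gamma> a b i] I sub ab that J(3) by blast
    then have "F \<subseteq> ?A (\<gamma> a) \<union> ?A (\<gamma> b)" using J(3) by blast
    then have "card F \<le> card (?A (\<gamma> a) \<union> ?A (\<gamma> b))" using F by (intro card_mono) auto
    also have "\<dots> \<le> card (?A (\<gamma> a)) + card (?A (\<gamma> b))" by (rule card_Un_le)
    also have "\<dots> \<le> k + k"
      using F by (intro add_mono bound[OF V(1)] bound[OF V(2)]) (auto simp: branching_def)
    finally show ?thesis by simp
  qed (simp add: J)
qed

section \<open>The uniform flow\<close>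

text \<open>The bound on branching is applied to this half-infinite geodesic, which makes the
  branching ancestors of a vertex finite in number.\<close>

lemma ancestors_geodesic:
  assumes "x \<in> V"
  shows "range (\<lambda>j. (father ^^ j) x) \<in> geodesics V E"
proof -
  have *: "gdist E ((father ^^ i) x) ((father ^^ j) x) = j - i" if "i \<le> j" for i j
    using gdist_funpow_father[OF funpow_father_in_V[OF assms], of i "j - i"] that
    by (simp flip: funpow_add[THEN fun_cong, unfolded o_apply])
  have dist: "int (gdist E ((father ^^ nat i) x) ((father ^^ nat j) x)) = \<bar>i - j\<bar>"
    if "i \<in> {0..}" "j \<in> {0..}" for i j
    using *[of "nat i" "nat j"] *[of "nat j" "nat i"] that by (cases "i \<le> j") (auto simp: gdist_sym)
  have "range (\<lambda>j. (father ^^ j) x) = (\<lambda>i. (father ^^ nat i) x) ` {0::int..}"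
    by (force intro: image_eqI[where x = "int _"])
  then show ?thesis
    unfolding geodesics_def using dist assms
    by (auto intro!: exI[of _ "\<lambda>i. (father ^^ nat i) x"] exI[of _ "{0::int..}"] funpow_father_in_V)
qed

text \<open>Proper ancestors only: the number of sons of \<open>x\<close> must not affect the mass
  of \<open>x\<close> itself.\<close>

definition branching_ancestors :: "'a \<Rightarrow> 'a set" where
  "branching_ancestors x = {y. branching y \<and> (\<exists>j. y = (father ^^ Suc j) x)}"

text \<open>
  Normalised at the root: the flow tends to 1 along every ascending ray.
\<close>

definition uniform_flow :: "'a \<Rightarrow> real" where
  "uniform_flow x = inverse (\<Prod>y\<in>branching_ancestors x. real (card (sons E \<omega> y)))"

lemma branching_ancestors_father:
  "branching_ancestors x =
    (if branching (father x) then insert (father x) (branching_ancestors (father x))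
     else branching_ancestors (father x))"
proof -
  have "(\<exists>j. y = (father ^^ Suc j) x) \<longleftrightarrow> y = father x \<or> (\<exists>j. y = (father ^^ Suc j) (father x))" for y
  proof
    assume "\<exists>j. y = (father ^^ Suc j) x"
    then obtain j where "y = (father ^^ Suc j) x" by blast
    then show "y = father x \<or> (\<exists>j. y = (father ^^ Suc j) (father x))"
      by (cases j) (auto simp: funpow_swap1)
  next
    assume "y = father x \<or> (\<exists>j. y = (father ^^ Suc j) (father x))"
    then show "\<exists>j. y = (father ^^ Suc j) x"
    proof
      assume "\<exists>j. y = (father ^^ Suc j) (father x)"
      then obtain j where "y = (father ^^ Suc (Suc j)) x" by (auto simp: funpow_swap1)
      then show ?thesis by blast
    qed (auto intro: exI[of _ 0])
  qed
  then show ?thesis by (auto simp: branching_ancestors_def simp del: funpow.simps)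
qed

lemma not_in_branching_ancestors: "x \<in> V \<Longrightarrow> x \<notin> branching_ancestors x"
  using funpow_father_inj[of x 0] by (auto simp: branching_ancestors_def simp del: funpow.simps)

context
  fixes q M :: nat
  assumes no_leaves: "\<forall>x\<in>V. sons E \<omega> x \<noteq> {}"
    and degree: "\<And>x. x \<in> V \<Longrightarrow> num_sons E \<omega> x \<le> enat q"
    and branch: "\<And>g. g \<in> geodesics V E \<Longrightarrow> num_branching E \<omega> g \<le> enat M"
begin

lemma sons_bounds:
  assumes "x \<in> V"
  shows "finite (sons E \<omega> x)" "1 \<le> card (sons E \<omega> x)" "card (sons E \<omega> x) \<le> q"
  using ecard_le_enatD[of "sons E \<omega> x" q] degree[OF assms] no_leaves assms
  by (auto simp: num_sons_def Suc_le_eq card_gt_0_iff)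

lemma branching_ancestors_bounds:
  assumes "x \<in> V"
  shows "finite (branching_ancestors x)" "card (branching_ancestors x) \<le> M"
    "branching_ancestors x \<subseteq> V"
proof -
  let ?g = "range (\<lambda>j. (father ^^ j) x)"
  have fin: "finite {y \<in> ?g. 2 \<le> num_sons E \<omega> y}" "card {y \<in> ?g. 2 \<le> num_sons E \<omega> y} \<le> M"
    using ecard_le_enatD branch[OF ancestors_geodesic[OF assms]] by (auto simp: num_branching_def)
  have sub: "branching_ancestors x \<subseteq> {y \<in> ?g. 2 \<le> num_sons E \<omega> y}"
    unfolding branching_ancestors_def branching_def by blast
  show "finite (branching_ancestors x)" using fin sub finite_subset by blast
  show "card (branching_ancestors x) \<le> M" using card_mono[OF fin(1) sub] fin(2) by simp
  show "branching_ancestors x \<subseteq> V" using sub funpow_father_in_V[OF assms] by blast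
qed

text \<open>The product has at most \<open>M\<close> factors, each between 1 and
  \<open>q\<close>.\<close>

lemma uniform_flow_bounds:
  assumes "x \<in> V"
  shows "inverse (real q ^ M) \<le> uniform_flow x" "uniform_flow x \<le> 1" "0 < uniform_flow x"
proof -
  let ?P = "\<Prod>y\<in>branching_ancestors x. real (card (sons E \<omega> y))"
  have b: "1 \<le> real (card (sons E \<omega> y))" "real (card (sons E \<omega> y)) \<le> real q"
    if "y \<in> branching_ancestors x" for y
    using sons_bounds[of y] branching_ancestors_bounds[OF assms] that by auto
  have "1 \<le> real q" using sons_bounds[OF assms] by linarith
  then have "?P \<le> real q ^ M"
    using b branching_ancestors_bounds[OF assms] by (intro prod_le_power) force+
  moreover have "1 \<le> ?P" using b by (intro prod_ge_1) auto
  ultimately show "inverse (real q ^ M) \<le> uniform_flow x" "uniform_flow x \<le> 1" "0 < uniform_flow x"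
    by (auto simp: uniform_flow_def intro: le_imp_inverse_le inverse_le_1_iff[THEN iffD2])
qed

text \<open>Passing from \<open>father x\<close> to \<open>x\<close> adds to the product only the
  factor of \<open>father x\<close>. If that vertex is not branching it has exactly one son, and the
  omitted factor is 1.\<close>

lemma uniform_flow_father:
  assumes "x \<in> V"
  shows "uniform_flow (father x) = real (card (sons E \<omega> (father x))) * uniform_flow x"
proof -
  let ?y = "father x"
  have y: "?y \<in> V" using father_in_V[OF assms] .
  have c: "real (card (sons E \<omega> ?y)) \<noteq> 0" using sons_bounds[OF y] by auto
  show ?thesis
  proof (cases "branching ?y")
    case True
    then have "uniform_flow x = inverse (real (card (sons E \<omega> ?y))) * uniform_flow ?y"
      using branching_ancestors_father[of x] branching_ancestors_bounds[OF y]
        not_in_branching_ancestors[OF y] by (simp add: uniform_flow_def)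
    with c show ?thesis by simp
  next
    case False
    then have "card (sons E \<omega> ?y) = 1"
      using sons_bounds[OF y] by (auto simp: branching_def num_sons_def ecard_def numeral_eq_enat)
    with False branching_ancestors_father[of x] show ?thesis by (simp add: uniform_flow_def)
  qed
qed

lemma flow_measure_uniform_flow: "flow_measure V E \<omega> uniform_flow"
  unfolding flow_measure_def
proof (intro conjI ballI)
  fix x assume x: "x \<in> V"
  then show "0 < uniform_flow x" by (rule uniform_flow_bounds)
  have "uniform_flow x = (\<Sum>y\<in>sons E \<omega> x. uniform_flow x / real (card (sons E \<omega> x)))"
    using sons_bounds[OF x] no_leaves x by simp
  also have "\<dots> = (\<Sum>y\<in>sons E \<omega> x. uniform_flow y)"
    using uniform_flow_father sons_bounds[OF x]
    by (intro sum.cong) (auto simp: sons_iff[OF x])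
  finally show "(uniform_flow has_sum uniform_flow x) (sons E \<omega> x)"
    using sons_bounds[OF x] by (intro has_sum_finiteI)
qed

lemma doubling_uniform_flow: "doubling V E uniform_flow"
  unfolding doubling_def
proof (intro exI conjI ballI allI impI)
  let ?Q = "real q ^ M"
  have "1 \<le> q" using sons_bounds[OF ray_in_V] le_trans by blast
  then have Q: "1 \<le> ?Q" by simp
  \<comment> \<open>The 4 comes from \<open>4 * r + 1 \<le> 4 * (r + 1)\<close>, and
    \<open>?Q\<close> is the ratio of the upper bound 1 to the lower bound \<open>inverse ?Q\<close>
    of the flow.\<close>
  then show "1 < 4 * ?Q" by linarith
  fix x and r :: nat assume x: "x \<in> V" and "0 < r"
  have "mass uniform_flow (gball V E x (2 * r))
      \<le> ennreal (real (2 * (2 * r) + 1) * uniform_flow ((father ^^ (2 * r)) x))"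
    by (rule mass_gball_le[OF flow_measure_uniform_flow x])
  also have "\<dots> \<le> ennreal (real (4 * (r + 1)) * 1)"
    using uniform_flow_bounds[OF funpow_father_in_V[OF x]]
    by (intro ennreal_leI mult_mono) (auto intro: less_imp_le)
  \<comment> \<open>The factor \<open>r + 1\<close> becomes a sum of lower bounds, one for the
    ancestor of each order \<open>j \<le> r\<close> in the smaller ball.\<close>
  also have "real (4 * (r + 1)) * 1 = 4 * ?Q * (\<Sum>j\<le>r. inverse ?Q)"
    using \<open>1 \<le> q\<close> by (simp add: field_simps)
  also have "\<dots> \<le> ennreal (4 * ?Q * (\<Sum>j\<le>r. uniform_flow ((father ^^ j) x)))"
    using uniform_flow_bounds(1)[OF funpow_father_in_V[OF x]]
    by (intro ennreal_leI mult_left_mono sum_mono) auto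
  also have "\<dots> = ennreal (4 * ?Q) * ennreal (\<Sum>j\<le>r. uniform_flow ((father ^^ j) x))"
    using Q by (intro ennreal_mult') simp
  also have "\<dots> \<le> ennreal (4 * ?Q) * mass uniform_flow (gball V E x r)"
    by (intro mult_left_mono mass_gball_ge[OF flow_measure_uniform_flow x]) simp
  finally show "mass uniform_flow (gball V E x (2 * r))
      \<le> ennreal (4 * ?Q) * mass uniform_flow (gball V E x r)" .
qed

end

text \<open>The converse requires sons: a tree consisting of the ray alone has bounded degree and no
  branching, but its origin has no son, and an empty sum is not positive.\<close>

lemma ex_doubling_flow_measure_iff:
  assumes no_leaves: "\<forall>x\<in>V. sons E \<omega> x \<noteq> {}"
  shows "(\<exists>m. flow_measure V E \<omega> m \<and> doubling V E m) \<longleftrightarrow>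
    uniformly_bounded_degree V E \<omega> \<and>
    (SUP \<gamma>\<in>geodesics V E. num_branching E \<omega> \<gamma>) < \<infinity>"
proof
  assume "\<exists>m. flow_measure V E \<omega> m \<and> doubling V E m"
  then obtain m C where m: "flow_measure V E \<omega> m" and C: "C > 1" "\<forall>x\<in>V. \<forall>r::nat. r > 0 \<longrightarrow>
      mass m (gball V E x (2 * r)) \<le> ennreal C * mass m (gball V E x r)"
    unfolding doubling_def by blast
  define K where "K = 4 * C"
  have "K > 0" using C by (simp add: K_def)
  have K: "m ((father ^^ n) x) \<le> K * m x" if "x \<in> V" for x n
    unfolding K_def by (rule doubling_flow_measure_ancestor_le[OF no_leaves m C that])
  have "num_sons E \<omega> x \<le> enat (nat \<lfloor>K\<rfloor>)" if "x \<in> V" for x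
    unfolding num_sons_def
  proof (rule ecard_leI)
    fix F assume "finite F" "F \<subseteq> sons E \<omega> x"
    with card_sons_le[OF m, of K x F] K[of _ 1] that have "real (card F) \<le> K" by simp
    then show "card F \<le> nat \<lfloor>K\<rfloor>" by (rule le_nat_floor)
  qed
  \<comment> \<open>Two lines of ancestors, each with at most \<open>K\<^sup>2 + 1\<close> branching
    vertices.\<close>
  moreover have "(SUP \<gamma>\<in>geodesics V E. num_branching E \<omega> \<gamma>) \<le> enat (2 * nat \<lfloor>K\<^sup>2 + 1\<rfloor>)"
  proof (rule SUP_least, rule num_branching_geodesic_le)
    fix x F
    assume F: "x \<in> V" "finite F" "F \<subseteq> range (\<lambda>j. (father ^^ j) x)" "\<And>y. y \<in> F \<Longrightarrow> branching y"
    have "real (card F) \<le> K\<^sup>2 + 1" by (rule card_branching_ancestors_le[OF m \<open>K > 0\<close> K F])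
    then show "card F \<le> nat \<lfloor>K\<^sup>2 + 1\<rfloor>" by (rule le_nat_floor)
  qed
  ultimately show "uniformly_bounded_degree V E \<omega> \<and>
      (SUP \<gamma>\<in>geodesics V E. num_branching E \<omega> \<gamma>) < \<infinity>"
    unfolding uniformly_bounded_degree_def by (auto dest: enat_ile)
next
  assume "uniformly_bounded_degree V E \<omega> \<and>
    (SUP \<gamma>\<in>geodesics V E. num_branching E \<omega> \<gamma>) < \<infinity>"
  then obtain q M where q: "\<And>x. x \<in> V \<Longrightarrow> num_sons E \<omega> x \<le> enat q"
    and M: "(SUP \<gamma>\<in>geodesics V E. num_branching E \<omega> \<gamma>) = enat M"
    unfolding uniformly_bounded_degree_def by (auto elim: less_infinityE)
  have branch: "num_branching E \<omega> g \<le> enat M" if "g \<in> geodesics V E" for g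
    using SUP_upper[OF that, of "num_branching E \<omega>"] by (simp add: M)
  show "\<exists>m. flow_measure V E \<omega> m \<and> doubling V E m"
    using flow_measure_uniform_flow[OF no_leaves q branch]
      doubling_uniform_flow[OF no_leaves q branch] by blast
qed

end

theorem theorem2p5:
  fixes V :: "'a set" and E :: "'a \<Rightarrow> 'a \<Rightarrow> bool" and \<omega> :: "nat \<Rightarrow> 'a"
  assumes "tree_rooted_at_infinity V E \<omega>"
    and no_leaves: "\<forall>x\<in>V. sons E \<omega> x \<noteq> {}"
  shows "(\<exists>m. flow_measure V E \<omega> m \<and> doubling V E m) \<longleftrightarrow>
    uniformly_bounded_degree V E \<omega> \<and>
    (SUP \<gamma>\<in>geodesics V E. num_branching E \<omega> \<gamma>) < \<infinity>"
  by (rule tree_rooted_at_infinity.ex_doubling_flow_measure_iff[OF assms])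

end
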